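(* Let $r\ge 1$ and $k\ge 2$ be integers. A number $\lambda$ is an eigenvalue of the adjacency operator of the $k$-ary rooted tree $X_r^k$ if and only if $\lambda$ is a root of at least one of the polynomials $P^k_2(x),P^k_3(x),\dots,P^k_{r+2}(x)$.
   Context: $X_r^k$ denotes the $k$-ary rooted tree of depth $r$: a finite tree with a distinguished root in which every node at distance less than $r$ from the root has exactly $k$ children (neighbours one step farther from the root), and the nodes at distance $r$ from the root are the leaves (degree 1). The adjacency operator $A$ acts on complex-valued functions $v$ on the nodes by $(Av)_\gamma=\sum_{\beta\sim\gamma}v_\beta$, the sum being over nodes $\beta$ adjacent to $\gamma$. For $k\ge 2$ the polynomials $P^k_n(x)$ are defined by $P^k_0(x)=0$, $P^k_1(x)=1$, and $P^k_n(x)=xP^k_{n-1}(x)-kP^k_{n-2}(x)$ for $n\ge 2$. *)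

theory Defs
  imports "HOL-Computational_Algebra.Polynomial" "Graph_Theory.Graph_Theory"
begin

text \<open>
  Finite simple graphs are rendered as \<^const>\<open>pair_graph\<close>: the arc set is a finite symmetric
  irreflexive relation on the finite vertex set, and \<open>(u, w) \<in> parcs G\<close> means that \<open>u\<close> and \<open>w\<close> are
  adjacent.

  In such a graph \<^const>\<open>pre_digraph.cycle\<close> also holds of \<open>u, w, u\<close> for every edge, so
  \<^const>\<open>tree\<close> is unusable here. The closed walks it describes that have at least three arcs are
  exactly the cycles of the undirected graph.
\<close>

definition undirected_tree :: "'a pair_pre_digraph \<Rightarrow> bool" where
  "undirected_tree G \<longleftrightarrow>
     pair_graph G \<and> connected (with_proj G) \<and>
     \<not> (\<exists>p. pre_digraph.cycle (with_proj G) p \<and> 3 \<le> length p)"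

text \<open>Only meaningful for vertices joined by a walk, hence for all vertices of a connected graph.\<close>

definition graph_dist :: "'a pair_pre_digraph \<Rightarrow> 'a \<Rightarrow> 'a \<Rightarrow> nat" where
  "graph_dist G u w = (LEAST n. (u, w) \<in> parcs G ^^ n)"

definition children :: "'a pair_pre_digraph \<Rightarrow> 'a \<Rightarrow> 'a \<Rightarrow> 'a set" where
  "children G \<rho> u =
     {w. (u, w) \<in> parcs G \<and> graph_dist G \<rho> w = graph_dist G \<rho> u + 1}"

text \<open>
  As \<open>G\<close> is symmetric, the degree of a node is its out-degree. Intended for \<open>1 \<le> r\<close> and
  \<open>2 \<le> k\<close>; for \<open>r = 0\<close> the degree condition cannot be met by a one-node tree.
\<close>

definition kary_rooted_tree :: "nat \<Rightarrow> nat \<Rightarrow> 'a pair_pre_digraph \<Rightarrow> 'a \<Rightarrow> bool" where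
  "kary_rooted_tree k r G \<rho> \<longleftrightarrow>
     undirected_tree G \<and> \<rho> \<in> pverts G \<and>
     (\<forall>u \<in> pverts G.
        graph_dist G \<rho> u \<le> r \<and>
        (graph_dist G \<rho> u < r \<longrightarrow> card (children G \<rho> u) = k) \<and>
        (graph_dist G \<rho> u = r \<longrightarrow> out_degree (with_proj G) u = 1))"

definition adjacency_op :: "'a pair_pre_digraph \<Rightarrow> ('a \<Rightarrow> complex) \<Rightarrow> 'a \<Rightarrow> complex" where
  "adjacency_op G v \<gamma> = (\<Sum>\<beta> | (\<gamma>, \<beta>) \<in> parcs G. v \<beta>)"

text \<open>
  A function on the nodes is a function on the whole type whose values off \<^term>\<open>pverts G\<close> are
  disregarded, so being a nonzero function and satisfying the eigenvalue equation are both
  relativised to \<^term>\<open>pverts G\<close>.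
\<close>

definition adjacency_eigenvalue :: "'a pair_pre_digraph \<Rightarrow> complex \<Rightarrow> bool" where
  "adjacency_eigenvalue G lam \<longleftrightarrow>
     (\<exists>v. (\<exists>\<gamma> \<in> pverts G. v \<gamma> \<noteq> 0) \<and> (\<forall>\<gamma> \<in> pverts G. adjacency_op G v \<gamma> = lam * v \<gamma>))"

fun P_poly :: "nat \<Rightarrow> nat \<Rightarrow> complex poly" where
  "P_poly k 0 = 0"
| "P_poly k (Suc 0) = 1"
| "P_poly k (Suc (Suc n)) = [:0, 1:] * P_poly k (Suc n) - of_nat k * P_poly k n"

end

theory Submission
  imports Defs
begin

text \<open>
  Let \<open>h\<close> be the height of a node above the leaves. If \<open>v\<close> is an eigenvector for \<open>x\<close>, then induction
  on \<open>h\<close>, starting at the leaves, gives \<open>P\<^sub>h\<^sub>+\<^sub>2(x) v(u) = P\<^sub>h\<^sub>+\<^sub>1(x) v(parent u)\<close>, where the right-hand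
  side is replaced by \<open>0\<close> at the root. If no \<open>P\<^sub>h\<^sub>+\<^sub>2(x)\<close> vanishes, \<open>v\<close> therefore vanishes from the root
  downwards.

  Conversely, let \<open>P\<^sub>h\<^sub>+\<^sub>2(x) = 0\<close> and let \<open>c\<close> have height \<open>h\<close>. Giving each descendant of \<open>c\<close> of height
  \<open>i\<close> the value \<open>P\<^sub>i\<^sub>+\<^sub>1(x)\<close>, and all other nodes \<open>0\<close>, yields a vector that violates the eigenvalue
  equation at most at the parent of \<open>c\<close>. There is no violation if \<open>c\<close> is the root, and otherwise the
  difference of two such vectors, for two children of the same node, is an eigenvector.
\<close>

section \<open>Depth and parents in a rooted tree\<close>

locale rooted_undirected_tree =
  fixes G :: "'a pair_pre_digraph" and \<rho> :: 'a
  assumes tree: "undirected_tree G" and root_in_verts: "\<rho> \<in> pverts G"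

sublocale rooted_undirected_tree \<subseteq> pair_graph G
  using tree by (simp add: undirected_tree_def)

context rooted_undirected_tree
begin

abbreviation depth :: "'a \<Rightarrow> nat" where
  "depth \<equiv> graph_dist G \<rho>"

lemma parcs_sym: "(u, w) \<in> parcs G \<Longrightarrow> (w, u) \<in> parcs G"
  using pair_sym_arcs by (simp add: symmetric_def sym_def)

lemma relpow_depth:
  assumes "u \<in> pverts G"
  shows "(\<rho>, u) \<in> parcs G ^^ depth u"
proof -
  have "connected (with_proj G)"
    using tree by (simp add: undirected_tree_def)
  then have "(\<rho>, u) \<in> (arcs_ends (mk_symmetric G))\<^sup>*"
    using assms root_in_verts
    by (intro reachable_rtranclI) (simp add: connected_def strongly_connected_def)
  moreover have "arcs_ends (mk_symmetric G) \<subseteq> parcs G"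
    by (auto dest: parcs_sym simp: parcs_mk_symmetric)
  ultimately have "(\<rho>, u) \<in> (parcs G)\<^sup>*"
    using rtrancl_mono by blast
  then obtain n where "(\<rho>, u) \<in> parcs G ^^ n"
    by (auto simp: rtrancl_power)
  then show ?thesis
    unfolding graph_dist_def by (rule LeastI)
qed

lemma depth_le: "(\<rho>, u) \<in> parcs G ^^ n \<Longrightarrow> depth u \<le> n"
  unfolding graph_dist_def by (rule Least_le)

lemma depth_root: "depth \<rho> = 0"
  using depth_le[of \<rho> 0] by simp

lemma depth_eq_0: "u \<in> pverts G \<Longrightarrow> depth u = 0 \<Longrightarrow> u = \<rho>"
  using relpow_depth[of u] by simp

lemma depth_arc: "(u, w) \<in> parcs G \<Longrightarrow> depth w \<le> Suc (depth u)"
  by (rule depth_le) (use relpow_depth in_arcsD1 in auto)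

lemma obtain_parent:
  assumes "u \<in> pverts G" "u \<noteq> \<rho>"
  obtains p where "(u, p) \<in> parcs G" "depth u = Suc (depth p)"
proof -
  obtain n where n: "depth u = Suc n"
    using assms depth_eq_0 by (cases "depth u") auto
  then obtain p where p: "(\<rho>, p) \<in> parcs G ^^ n" "(p, u) \<in> parcs G"
    using relpow_depth[OF assms(1)] by auto
  have "depth u = Suc (depth p)"
    using depth_le[OF p(1)] depth_arc[OF p(2)] n by simp
  then show thesis
    using that p parcs_sym by blast
qed

section \<open>Acyclicity: at most one neighbour of a node is not deeper\<close>

lemma awalk_avoiding:
  assumes "(x, y) \<in> {(a, b) \<in> parcs G. a \<noteq> u \<and> b \<noteq> u}\<^sup>*" "x \<in> pverts G" "x \<noteq> u"
  shows "\<exists>p. awalk x p y \<and> u \<notin> set (pawalk_verts x p)"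
  using assms
proof (induction rule: converse_rtrancl_induct)
  case base
  then show ?case
    by (intro exI[of _ "[]"]) (simp add: awalk_Nil_iff)
next
  case (step x z)
  then obtain p where "awalk z p y" "u \<notin> set (pawalk_verts z p)"
    using in_arcsD2 by auto
  with step show ?case
    by (intro exI[of _ "(x, z) # p"]) (auto simp: awalk_Cons_iff)
qed

text \<open>Such a walk could be shortened to a path, and closing it through \<open>u\<close> would
  give a cycle. As \<open>x\<close> and \<open>y\<close> differ, the path has an arc, so the cycle
  has length at least 3 and is not the degenerate \<open>u, x, u\<close>.\<close>

lemma neighbours_not_joined:
  assumes "(u, x) \<in> parcs G" "(u, y) \<in> parcs G" "x \<noteq> y"
  shows "(x, y) \<notin> {(a, b) \<in> parcs G. a \<noteq> u \<and> b \<noteq> u}\<^sup>*"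
proof
  assume "(x, y) \<in> {(a, b) \<in> parcs G. a \<noteq> u \<and> b \<noteq> u}\<^sup>*"
  moreover have ne: "x \<noteq> u" "y \<noteq> u"
    using assms pair_no_loops by fastforce+
  ultimately obtain q where q: "awalk x q y" "u \<notin> set (pawalk_verts x q)"
    using awalk_avoiding assms in_arcsD2 by blast
  define p where "p = awalk_to_apath q"
  have p: "apath x p y"
    unfolding p_def using q(1) by (rule apath_awalk_to_apath)
  then have xpy: "awalk x p y"
    by (simp add: apath_def)
  have "set p \<subseteq> set q"
    unfolding p_def using q(1) by (rule awalk_to_apath_subset)
  then have up: "u \<notin> set (pawalk_verts x p)"
    using q set_awalk_verts[OF xpy] set_awalk_verts[OF q(1)] by auto
  have "p \<noteq> []"
    using xpy assms(3) by (auto simp: awalk_Nil_iff)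
  let ?c = "(u, x) # p @ [(y, u)]"
  have "awalk y [(y, u)] u"
    using assms parcs_sym in_arcsD1 by (auto simp: awalk_Cons_iff awalk_Nil_iff)
  with xpy have xpyu: "awalk x (p @ [(y, u)]) u"
    by (rule awalk_appendI)
  then have "awalk u ?c u"
    using assms(1) unfolding awalk_Cons_iff fst_conv snd_conv by blast
  moreover have "distinct (tl (pawalk_verts u ?c))"
  proof -
    have "pawalk_verts x (p @ [(y, u)]) = pawalk_verts x p @ [u]"
      using awalk_verts_append[OF xpyu] by simp
    then show ?thesis
      using p up by (simp add: apath_def)
  qed
  ultimately have "cycle ?c"
    by (auto simp: cycle_def)
  moreover have "3 \<le> length ?c"
    using \<open>p \<noteq> []\<close> by (cases p) auto
  ultimately show False
    using tree unfolding undirected_tree_def by blast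
qed

text \<open>Climb from parent to parent: after the first step every depth is strictly below that of
  \<open>u\<close>, so the walk never meets \<open>u\<close>.\<close>

lemma root_joined_avoiding:
  assumes "w \<in> pverts G" "w \<noteq> u" "depth w \<le> depth u"
  shows "(w, \<rho>) \<in> {(a, b) \<in> parcs G. a \<noteq> u \<and> b \<noteq> u}\<^sup>*"
  using assms
proof (induction "depth w" arbitrary: w rule: less_induct)
  case less
  show ?case
  proof (cases "w = \<rho>")
    case False
    then obtain p where p: "(w, p) \<in> parcs G" "depth w = Suc (depth p)"
      using less.prems obtain_parent by blast
    have "p \<noteq> u"
      using p less.prems by auto
    moreover have "(p, \<rho>) \<in> {(a, b) \<in> parcs G. a \<noteq> u \<and> b \<noteq> u}\<^sup>*"
      using p less.prems in_arcsD2 \<open>p \<noteq> u\<close> by (intro less.hyps) auto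
    ultimately show ?thesis
      using p less.prems by (auto intro: converse_rtrancl_into_rtrancl)
  qed simp
qed

text \<open>Two such neighbours would be joined through the root while avoiding \<open>u\<close>.
  Admitting equal depth also rules out arcs within one level.\<close>

lemma shallow_neighbour_unique:
  assumes "(u, x) \<in> parcs G" "(u, y) \<in> parcs G" "depth x \<le> depth u" "depth y \<le> depth u"
  shows "x = y"
proof (rule ccontr)
  assume "x \<noteq> y"
  let ?R = "{(a, b) \<in> parcs G. a \<noteq> u \<and> b \<noteq> u}"
  have ne: "x \<noteq> u" "y \<noteq> u"
    using assms pair_no_loops by fastforce+
  have "(x, \<rho>) \<in> ?R\<^sup>*" "(y, \<rho>) \<in> ?R\<^sup>*"
    using root_joined_avoiding ne assms in_arcsD2 by blast+
  moreover have "sym (?R\<^sup>*)"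
    by (rule sym_rtrancl) (auto simp: sym_def intro: parcs_sym)
  ultimately have "(x, y) \<in> ?R\<^sup>*"
    by (meson rtrancl_trans symD)
  with neighbours_not_joined assms \<open>x \<noteq> y\<close> show False
    by blast
qed

text \<open>Unspecified at the root, hence the case distinctions on \<open>u = \<rho>\<close>
  below.\<close>

definition parent :: "'a \<Rightarrow> 'a" where
  "parent u = (SOME p. (u, p) \<in> parcs G \<and> depth u = Suc (depth p))"

lemma parent:
  assumes "u \<in> pverts G" "u \<noteq> \<rho>"
  shows "(u, parent u) \<in> parcs G" "depth u = Suc (depth (parent u))"
proof -
  have "\<exists>p. (u, p) \<in> parcs G \<and> depth u = Suc (depth p)"
    using assms obtain_parent by blast
  then have "(u, parent u) \<in> parcs G \<and> depth u = Suc (depth (parent u))"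
    unfolding parent_def by (rule someI_ex)
  then show "(u, parent u) \<in> parcs G" "depth u = Suc (depth (parent u))"
    by auto
qed

lemma in_children_iff:
  "w \<in> children G \<rho> u \<longleftrightarrow> w \<in> pverts G \<and> w \<noteq> \<rho> \<and> u = parent w"
proof
  assume "w \<in> children G \<rho> u"
  then have w: "(u, w) \<in> parcs G" "depth w = Suc (depth u)"
    by (auto simp: children_def)
  then have *: "w \<in> pverts G" "w \<noteq> \<rho>"
    using in_arcsD2 depth_root by auto
  moreover have "u = parent w"
    using parent[OF *] w parcs_sym by (intro shallow_neighbour_unique[of w]) auto
  ultimately show "w \<in> pverts G \<and> w \<noteq> \<rho> \<and> u = parent w"
    by simp
next
  assume "w \<in> pverts G \<and> w \<noteq> \<rho> \<and> u = parent w"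
  then show "w \<in> children G \<rho> u"
    using parent[of w] parcs_sym by (auto simp: children_def)
qed

lemma neighbours_eq:
  assumes "u \<in> pverts G"
  shows "{w. (u, w) \<in> parcs G} = children G \<rho> u \<union> (if u = \<rho> then {} else {parent u})"
proof -
  have "w \<in> children G \<rho> u \<or> u \<noteq> \<rho> \<and> w = parent u" if "(u, w) \<in> parcs G" for w
  proof (cases "depth w \<le> depth u")
    case True
    \<comment> \<open>At the root, \<open>w\<close> would have depth 0 as well, so the arc would be
      a loop.\<close>
    have "u \<noteq> \<rho>"
      using True that depth_eq_0[of w] in_arcsD2 pair_no_loops[OF that] depth_root by auto
    moreover have "w = parent u"
      using parent[OF assms \<open>u \<noteq> \<rho>\<close>] that True by (intro shallow_neighbour_unique[of u]) auto
    ultimately show ?thesis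
      by simp
  next
    case False
    then show ?thesis
      using that depth_arc[OF that] by (auto simp: children_def)
  qed
  moreover have "children G \<rho> u \<subseteq> {w. (u, w) \<in> parcs G}"
    by (auto simp: children_def)
  ultimately show ?thesis
    using parent(1)[OF assms] by auto
qed

lemma finite_children: "finite (children G \<rho> u)"
  by (rule finite_subset[OF _ pair_finite_verts]) (auto simp: in_children_iff)

lemma adjacency_op_eq:
  assumes "u \<in> pverts G"
  shows "adjacency_op G v u =
    (\<Sum>w\<in>children G \<rho> u. v w) + (if u = \<rho> then 0 else v (parent u))"
proof -
  have "parent u \<notin> children G \<rho> u" if "u \<noteq> \<rho>"
    using parent[OF assms that] by (auto simp: children_def)
  then show ?thesis
    unfolding adjacency_op_def neighbours_eq[OF assms]
    using finite_children by (auto simp: add.commute)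
qed

section \<open>Subtrees of descendants\<close>

definition subtree :: "'a \<Rightarrow> 'a set" where
  "subtree c = {(a, b). b \<in> children G \<rho> a}\<^sup>* `` {c}"

lemma self_in_subtree: "c \<in> subtree c"
  by (simp add: subtree_def)

text \<open>A nonempty descent from \<open>c\<close> to \<open>w\<close> must end with the step from
  the only parent of \<open>w\<close>.\<close>

lemma child_in_subtree_iff:
  assumes "w \<in> children G \<rho> u"
  shows "w \<in> subtree c \<longleftrightarrow> w = c \<or> u \<in> subtree c"
proof
  assume "w \<in> subtree c"
  then have "(c, w) \<in> {(a, b). b \<in> children G \<rho> a}\<^sup>*"
    by (simp add: subtree_def)
  then show "w = c \<or> u \<in> subtree c"
    using assms by cases (auto simp: subtree_def in_children_iff)
next
  assume "w = c \<or> u \<in> subtree c"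
  then show "w \<in> subtree c"
    using assms by (auto simp: subtree_def intro: rtrancl_into_rtrancl)
qed

lemma depth_subtree:
  assumes "u \<in> subtree c"
  shows "u = c \<or> depth c < depth u"
proof -
  have "(c, u) \<in> {(a, b). b \<in> children G \<rho> a}\<^sup>*"
    using assms by (simp add: subtree_def)
  then show ?thesis
    by induction (auto simp: children_def)
qed

end

section \<open>Values of the polynomials\<close>

lemma poly_P_poly_Suc_Suc:
  "poly (P_poly k (Suc (Suc n))) x = x * poly (P_poly k (Suc n)) x - of_nat k * poly (P_poly k n) x"
  by (simp add: of_nat_poly)

declare P_poly.simps(3) [simp del]

text \<open>Two consecutive zeros would propagate down the recurrence, as \<open>k\<close> can be
  divided out, and contradict \<open>P_1 = 1\<close>. This makes the eigenvectors constructed below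
  nonzero.\<close>

lemma P_poly_no_consecutive_roots:
  assumes "k \<noteq> 0"
  shows "poly (P_poly k n) x \<noteq> 0 \<or> poly (P_poly k (Suc n)) x \<noteq> 0"
proof (induction n)
  case (Suc n)
  then show ?case
    using assms by (auto simp: poly_P_poly_Suc_Suc)
qed simp

section \<open>Trees with k children at each inner node\<close>

locale kary_tree = rooted_undirected_tree +
  fixes k r :: nat
  assumes k_ge_2: "2 \<le> k" and kary: "kary_rooted_tree k r G \<rho>"
begin

lemma depth_le_r: "u \<in> pverts G \<Longrightarrow> depth u \<le> r"
  using kary by (simp add: kary_rooted_tree_def)

lemma card_children: "u \<in> pverts G \<Longrightarrow> depth u < r \<Longrightarrow> card (children G \<rho> u) = k"
  using kary by (simp add: kary_rooted_tree_def)

lemma children_leaf: "depth u = r \<Longrightarrow> children G \<rho> u = {}"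
  using depth_le_r by (fastforce simp: children_def dest: in_arcsD2)

abbreviation Pval :: "complex \<Rightarrow> nat \<Rightarrow> complex" where
  "Pval x n \<equiv> poly (P_poly k n) x"

text \<open>Read as the eigenvalue equation at a node of value \<open>Pval x (Suc n)\<close> with
  \<open>k\<close> children of value \<open>Pval x n\<close> and a parent of value
  \<open>Pval x (Suc (Suc n))\<close>.\<close>

lemma Pval_recurrence: "x * Pval x (Suc n) = of_nat k * Pval x n + Pval x (Suc (Suc n))"
  unfolding poly_P_poly_Suc_Suc by simp

lemma ex_vertex_at_depth: "n \<le> r \<Longrightarrow> \<exists>u\<in>pverts G. depth u = n"
proof (induction n)
  case 0
  then show ?case
    using root_in_verts depth_root by blast
next
  case (Suc n)
  then obtain u where "u \<in> pverts G" "depth u = n"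
    by auto
  then have "children G \<rho> u \<noteq> {}"
    using card_children[of u] Suc.prems k_ge_2 by auto
  then show ?case
    using \<open>depth u = n\<close> by (auto simp: children_def dest: in_arcsD2)
qed

section \<open>Eigenvalues are roots\<close>

lemma eigenvector_below_root:
  assumes v: "\<And>u. u \<in> pverts G \<Longrightarrow> adjacency_op G v u = lam * v u"
    and "u \<in> pverts G"
  shows "Pval lam (r - depth u + 2) * v u =
    (if u = \<rho> then 0 else Pval lam (r - depth u + 1) * v (parent u))"
  using assms(2)
proof (induction "r - depth u" arbitrary: u rule: less_induct)
  case less
  let ?h = "r - depth u"
  let ?S = "\<Sum>w\<in>children G \<rho> u. v w"
  \<comment> \<open>Leaves fit the general formula: the sum is empty and
    \<open>P_0 = 0\<close>.\<close>
  have sum: "Pval lam (Suc ?h) * ?S = of_nat k * Pval lam ?h * v u"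
  proof (cases "depth u = r")
    case True
    then show ?thesis
      by (simp add: children_leaf)
  next
    case False
    then have lt: "depth u < r"
      using depth_le_r less.prems by (simp add: le_neq_trans)
    have child: "Pval lam (Suc ?h) * v w = Pval lam ?h * v u" if "w \<in> children G \<rho> u" for w
    proof -
      have w: "w \<in> pverts G" "w \<noteq> \<rho>" "u = parent w" "depth w = Suc (depth u)"
        using that by (auto simp: in_children_iff parent(2))
      have h: "?h = Suc (r - depth w)"
        using lt w(4) by simp
      show ?thesis
        using less.hyps[of w] w h by simp
    qed
    have "Pval lam (Suc ?h) * ?S = (\<Sum>w\<in>children G \<rho> u. Pval lam ?h * v u)"
      unfolding sum_distrib_left using child by (intro sum.cong) auto
    also have "\<dots> = of_nat k * Pval lam ?h * v u"
      using card_children[OF less.prems lt] by simp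
    finally show ?thesis .
  qed
  \<comment> \<open>The eigenvalue equation is multiplied by the factor that makes
    \<open>sum\<close> applicable. No division occurs, so polynomials vanishing at
    \<open>lam\<close> do no harm.\<close>
  have "Pval lam (Suc ?h) * (lam * v u) =
    Pval lam (Suc ?h) * ?S + (if u = \<rho> then 0 else Pval lam (Suc ?h) * v (parent u))"
    unfolding v[OF less.prems, symmetric] adjacency_op_eq[OF less.prems, of v]
    by (simp add: distrib_left)
  then have "(lam * Pval lam (Suc ?h)) * v u = of_nat k * Pval lam ?h * v u +
      (if u = \<rho> then 0 else Pval lam (Suc ?h) * v (parent u))"
    unfolding sum by (simp add: mult_ac)
  then show ?case
    unfolding Pval_recurrence by (simp add: algebra_simps split: if_splits)
qed

lemma eigenvalue_imp_root:
  assumes "adjacency_eigenvalue G lam"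
  shows "\<exists>n\<in>{2..r + 2}. Pval lam n = 0"
proof (rule ccontr)
  assume "\<not> ?thesis"
  \<comment> \<open>Truncated subtraction keeps the index in \<open>{2..r + 2}\<close> for every
    \<open>h\<close>.\<close>
  then have nz: "Pval lam (r - h + 2) \<noteq> 0" for h
    by auto
  obtain v where v: "\<And>u. u \<in> pverts G \<Longrightarrow> adjacency_op G v u = lam * v u"
    and "\<exists>u\<in>pverts G. v u \<noteq> 0"
    using assms unfolding adjacency_eigenvalue_def by blast
  have "v u = 0" if "u \<in> pverts G" for u
    using that
  proof (induction "depth u" arbitrary: u rule: less_induct)
    case less
    have "v (parent u) = 0" if "u \<noteq> \<rho>"
      using parent[OF less.prems that] in_arcsD2 by (intro less.hyps) auto
    then have "Pval lam (r - depth u + 2) * v u = 0"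
      using eigenvector_below_root[OF v less.prems] by auto
    with nz show ?case
      by (metis mult_eq_0_iff)
  qed
  with \<open>\<exists>u\<in>pverts G. v u \<noteq> 0\<close> show False
    by blast
qed

section \<open>Roots are eigenvalues\<close>

definition subtree_vector :: "complex \<Rightarrow> 'a \<Rightarrow> 'a \<Rightarrow> complex" where
  "subtree_vector x c u = (if u \<in> subtree c then Pval x (r - depth u + 1) else 0)"

text \<open>Inside the subtree this is the recurrence, with \<open>P_1 = 1\<close> at the leaves and
  \<open>P_0 = 0\<close> for their missing children. The extra term is the defect at the parent of
  \<open>c\<close>, the only outside node adjacent to the subtree.\<close>

lemma adjacency_op_subtree_vector:
  assumes c: "c \<in> pverts G" and root: "Pval x (r - depth c + 2) = 0" and u: "u \<in> pverts G"
  shows "adjacency_op G (subtree_vector x c) u =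
    x * subtree_vector x c u + (if c \<in> children G \<rho> u then Pval x (r - depth c + 1) else 0)"
proof (cases "u \<in> subtree c")
  case True
  let ?h = "r - depth u"
  have "c \<notin> children G \<rho> u"
    using depth_subtree[OF True] by (auto simp: children_def)
  have "(\<Sum>w\<in>children G \<rho> u. subtree_vector x c w) = of_nat k * Pval x ?h"
  proof (cases "depth u = r")
    case False
    then have lt: "depth u < r"
      using depth_le_r u by (simp add: le_neq_trans)
    have "(\<Sum>w\<in>children G \<rho> u. subtree_vector x c w) = (\<Sum>w\<in>children G \<rho> u. Pval x ?h)"
    proof (rule sum.cong)
      fix w assume w: "w \<in> children G \<rho> u"
      then have "?h = Suc (r - depth w)"
        using lt by (auto simp: children_def)
      then show "subtree_vector x c w = Pval x ?h"
        using w True by (simp add: subtree_vector_def child_in_subtree_iff)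
    qed simp
    then show ?thesis
      using card_children[OF u lt] by simp
  qed (simp add: children_leaf)
  \<comment> \<open>At \<open>u = c\<close> both sides are 0: the right one by \<open>root\<close>,
    the left one because \<open>c\<close> is the root or its parent lies outside the
    subtree.\<close>
  moreover have "(if u = \<rho> then 0 else subtree_vector x c (parent u)) = Pval x (?h + 2)"
  proof (cases "u = c")
    case True
    have "c \<noteq> \<rho> \<Longrightarrow> parent c \<notin> subtree c"
      using depth_subtree[of "parent c" c] parent(2)[OF c] by fastforce
    then show ?thesis
      using True root by (simp add: subtree_vector_def)
  next
    case False
    then have "u \<noteq> \<rho>"
      using depth_subtree[OF True] depth_root by auto
    then have "parent u \<in> subtree c"
      using False True child_in_subtree_iff[of u "parent u" c] u by (simp add: in_children_iff)
    moreover have "r - depth (parent u) = Suc ?h"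
      using parent(2)[OF u \<open>u \<noteq> \<rho>\<close>] depth_le_r[OF u] by simp
    ultimately show ?thesis
      using \<open>u \<noteq> \<rho>\<close> by (simp add: subtree_vector_def)
  qed
  ultimately show ?thesis
    using True \<open>c \<notin> children G \<rho> u\<close> Pval_recurrence[of x ?h]
    by (simp add: adjacency_op_eq[OF u] subtree_vector_def)
next
  case False
  have "subtree_vector x c w = (if w = c then Pval x (r - depth c + 1) else 0)"
    if "w \<in> children G \<rho> u" for w
    using that False by (auto simp: subtree_vector_def child_in_subtree_iff)
  then have "(\<Sum>w\<in>children G \<rho> u. subtree_vector x c w) =
    (if c \<in> children G \<rho> u then Pval x (r - depth c + 1) else 0)"
    by (simp add: finite_children)
  moreover have "subtree_vector x c (parent u) = 0" if "u \<noteq> \<rho>"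
    using that False u child_in_subtree_iff[of u "parent u" c]
    by (simp add: subtree_vector_def in_children_iff)
  ultimately show ?thesis
    using False by (simp add: adjacency_op_eq[OF u] subtree_vector_def)
qed

lemma root_imp_eigenvalue:
  assumes "n \<in> {2..r + 2}" "Pval lam n = 0"
  shows "adjacency_eigenvalue G lam"
proof -
  obtain h where h: "n = h + 2" "h \<le> r"
    using assms(1) by (metis add_le_cancel_right atLeastAtMost_iff le_add_diff_inverse2)
  \<comment> \<open>This is the value at the top node of the subtree.\<close>
  have nz: "Pval lam (h + 1) \<noteq> 0"
    using P_poly_no_consecutive_roots[of k "h + 1" lam] assms(2) h k_ge_2
    by simp
  show ?thesis
  proof (cases "h = r")
    case True
    have "\<rho> \<notin> children G \<rho> u" for u
      by (simp add: in_children_iff)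
    then have "adjacency_op G (subtree_vector lam \<rho>) u = lam * subtree_vector lam \<rho> u"
      if "u \<in> pverts G" for u
      using adjacency_op_subtree_vector[OF root_in_verts _ that, of lam] assms(2) h True depth_root
      by simp
    moreover have "subtree_vector lam \<rho> \<rho> \<noteq> 0"
      using nz True by (simp add: subtree_vector_def self_in_subtree depth_root)
    ultimately show ?thesis
      unfolding adjacency_eigenvalue_def using root_in_verts by blast
  next
    case False
    \<comment> \<open>Nodes of height \<open>h\<close> have depth \<open>r - h\<close>; since
      \<open>h < r\<close>, they have parents one level up.\<close>
    then obtain w where w: "w \<in> pverts G" "depth w = r - h - 1"
      using ex_vertex_at_depth[of "r - h - 1"] by auto
    then have "1 < card (children G \<rho> w)"
      using card_children[of w] k_ge_2 h(2) False by simp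
    then obtain a b where ab: "a \<in> children G \<rho> w" "b \<in> children G \<rho> w" "a \<noteq> b"
      by (metis card_le_Suc0_iff_eq finite_children not_less One_nat_def)
    have in_verts: "a \<in> pverts G" "b \<in> pverts G"
      using ab by (auto simp: in_children_iff)
    have heights: "r - depth a = h" "r - depth b = h" "depth a = depth b"
      using ab w h(2) False by (auto simp: children_def)
    \<comment> \<open>Hence the two defects sit at the same node; they are equal because the heights
      agree, and cancel in \<open>v\<close>.\<close>
    have siblings: "a \<in> children G \<rho> u \<longleftrightarrow> b \<in> children G \<rho> u" for u
      using ab by (auto simp: in_children_iff)
    define v where "v u = subtree_vector lam a u - subtree_vector lam b u" for u
    have "adjacency_op G v u = lam * v u" if "u \<in> pverts G" for u
    proof -
      have "adjacency_op G v u =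
          adjacency_op G (subtree_vector lam a) u - adjacency_op G (subtree_vector lam b) u"
        by (simp add: adjacency_op_def v_def sum_subtractf)
      then show ?thesis
        using adjacency_op_subtree_vector[OF in_verts(1) _ that, of lam]
          adjacency_op_subtree_vector[OF in_verts(2) _ that, of lam]
          assms(2) h(1) heights siblings[of u]
        by (simp add: v_def right_diff_distrib)
    qed
    \<comment> \<open>Equal depth keeps \<open>a\<close> out of the subtree of \<open>b\<close>, so
      only the first vector contributes.\<close>
    moreover have "v a \<noteq> 0"
      using nz heights ab(3) depth_subtree[of a b]
      by (auto simp: v_def subtree_vector_def self_in_subtree)
    ultimately show ?thesis
      unfolding adjacency_eigenvalue_def using in_verts by blast
  qed
qed

end

theorem theorem1:
  fixes r k :: nat
    and G :: "'a pair_pre_digraph"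
    and \<rho> :: 'a
    and lam :: complex
  assumes "1 \<le> r"
    and "2 \<le> k"
    and "kary_rooted_tree k r G \<rho>"
  shows "adjacency_eigenvalue G lam \<longleftrightarrow> (\<exists>n \<in> {2..r + 2}. poly (P_poly k n) lam = 0)"
proof -
  interpret kary_tree G \<rho> k r
    using assms by unfold_locales (auto simp: kary_rooted_tree_def)
  show ?thesis
    using eigenvalue_imp_root root_imp_eigenvalue by blast
qed

end
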